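(* Let $p$ be a prime, $n\ge 1$ an integer, and let $G$ be the cyclic group $C_{p^n}$ with the presentation $$G=\langle x_1,x_2,\dots,x_n \mid x_1^p=1,\ x_2^p=x_1,\ \dots,\ x_n^p=x_{n-1}\rangle .$$ Let $F$ be an algebraically closed field of characteristic $0$. Then every primitive central idempotent of the group algebra $F[G]$ is of the form $$e_{\zeta_1x_1}e_{\zeta_2x_2}\cdots e_{\zeta_nx_n},$$ where $\zeta_n\in F$ is a $p^n$-th root of unity (not necessarily primitive) and $\zeta_{n-1},\dots,\zeta_1$ are the roots of unity in $F$ (with $\zeta_i$ a $p^i$-th root of unity) defined by $\zeta_n^p=\zeta_{n-1},\ \dots,\ \zeta_2^p=\zeta_1$.
   Context: For an element $X$ of a group algebra of $G$, $e_X$ denotes $\frac{1+X+X^2+\cdots+X^{p-1}}{p}$; thus $e_{\zeta x}=\frac1p\sum_{k=0}^{p-1}\zeta^k x^k$ for $\zeta\in F$ and $x\in G$. The presentation given is the one in which $x_n$ generates $G$ and $x_i=x_n^{p^{n-i}}$. *)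

theory Defs
  imports
    "HOL-Library.Poly_Mapping"
    "HOL-Computational_Algebra.Computational_Algebra"
begin

text \<open>
  The group algebra \<open>F[G]\<close> is the type \<open>'g \<Rightarrow>\<^sub>0 'f\<close> of finitely supported functions, whose ring
  multiplication in \<^theory>\<open>HOL-Library.Poly_Mapping\<close> is convolution over the index type. That
  theory writes the index monoid additively. So the group \<open>G\<close> is written additively below: the
  neutral element is \<open>0\<close> and a power \<open>x\<^sup>k\<close> in \<open>G\<close> is the \<open>k\<close>-fold sum \<open>\<Sum>_<k. x\<close>.
  The element \<open>\<zeta>x\<close> of \<open>F[G]\<close> is \<^term>\<open>Poly_Mapping.single x \<zeta>\<close>, and the scalar \<open>c\<close> is
  \<^term>\<open>Poly_Mapping.single 0 c\<close>.
\<close>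

definition central_idempotent :: "'a::ring_1 \<Rightarrow> bool" where
  "central_idempotent e \<longleftrightarrow> e * e = e \<and> (\<forall>a. e * a = a * e)"

definition primitive_central_idempotent :: "'a::ring_1 \<Rightarrow> bool" where
  "primitive_central_idempotent e \<longleftrightarrow>
     central_idempotent e \<and> e \<noteq> 0 \<and>
     (\<forall>f g. central_idempotent f \<and> central_idempotent g \<and> f * g = 0 \<and> e = f + g \<longrightarrow> f = 0 \<or> g = 0)"

text \<open>The element \<open>e\<^sub>X = (1 + X + \<dots> + X\<^bsup>p-1\<^esup>) / p\<close>; it need not be idempotent.\<close>

definition e_elem :: "nat \<Rightarrow> ('g::monoid_add \<Rightarrow>\<^sub>0 'f::field) \<Rightarrow> ('g \<Rightarrow>\<^sub>0 'f)" where
  "e_elem p X = Poly_Mapping.single 0 (1 / of_nat p) * (\<Sum>k<p. X ^ k)"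

lemma single_power:
  fixes x :: "'g::comm_monoid_add" and z :: "'f::field"
  shows "Poly_Mapping.single x z ^ k = Poly_Mapping.single (\<Sum>_<k. x) (z ^ k)"
  by (induction k) (simp_all add: mult_single add.commute mult.commute flip: single_one)

lemma e_elem_single:
  fixes x :: "'g::comm_monoid_add" and z :: "'f::field"
  shows "e_elem p (Poly_Mapping.single x z) =
    Poly_Mapping.single 0 (1 / of_nat p) * (\<Sum>k<p. Poly_Mapping.single (\<Sum>_<k. x) (z ^ k))"
  by (simp add: e_elem_def single_power)

end

theory Submission
  imports Defs
begin

text \<open>
  Put \<open>y = x\<^sub>n\<close> and \<open>N = p^n\<close>. For an \<open>N\<close>-th root of unity \<open>\<omega>\<close>, the factors with
  \<open>\<zeta>\<^sub>i = \<omega>^(p^(n-i))\<close> are averages over consecutive base-\<open>p\<close> digits, so their product is the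
  full average \<open>E\<^sub>\<omega> = (\<Sum>k<N. (\<omega> y)^k) / N\<close>. Multiplication by \<open>\<omega> y\<close> fixes \<open>E\<^sub>\<omega>\<close>; as \<open>y\<close>
  generates \<open>G\<close>, every element of the group algebra acts on \<open>E\<^sub>\<omega>\<close> as a scalar. By
  orthogonality of the roots of unity the \<open>E\<^sub>\<omega>\<close> add up to \<open>1\<close>. So a primitive \<open>e\<close> has
  \<open>e E\<^sub>\<omega> \<noteq> 0\<close> for some \<open>\<omega>\<close>; then \<open>e E\<^sub>\<omega> = E\<^sub>\<omega>\<close>, and primitivity forces \<open>e = E\<^sub>\<omega>\<close>.
\<close>

text \<open>In characteristic 0 the derivative of \<open>X^N - 1\<close> vanishes only at 0, which
  is not a root, so all roots are simple. Over an algebraically closed field their number is then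
  the degree.\<close>

lemma card_roots_of_unity:
  fixes N :: nat
  assumes "N > 0"
  shows "card {w :: 'f :: {alg_closed_field, field_char_0}. w ^ N = 1} = N"
proof -
  define P :: "'f poly" where "P = monom 1 N - 1"
  have poly_P: "poly P w = w ^ N - 1" for w
    by (simp add: P_def poly_monom)
  have deg: "degree P = N"
    unfolding P_def diff_conv_add_uminus
    using assms by (subst degree_add_eq_left) (auto simp: degree_monom_eq)
  then have "P \<noteq> 0" using assms by auto
  have "rsquarefree P"
    unfolding rsquarefree_roots
  proof (intro allI notI)
    fix a assume *: "poly P a = 0 \<and> poly (pderiv P) a = 0"
    then have "a ^ N = 1" "of_nat N * a ^ (N - 1) = 0"
      by (auto simp: poly_P) (auto simp: P_def pderiv_diff pderiv_monom poly_monom)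
    then show False using assms by (cases "a = 0") (auto simp: power_0_left)
  qed
  obtain A where A: "size A = degree P" "P = smult (lead_coeff P) (\<Prod>x\<in>#A. [:-x, 1:])"
    using alg_closed_imp_factorization[OF \<open>P \<noteq> 0\<close>] by blast
  \<comment> \<open>\<open>A\<close> lists the linear factors, so it is the multiset of roots and
    its size counts them with multiplicity.\<close>
  have "proots P = proots (\<Prod>x\<in>#A. [:-x, 1:])"
    using A(2) \<open>P \<noteq> 0\<close> by (metis leading_coeff_0_iff proots_smult)
  also have "\<dots> = A"
  proof (induction A)
    case (add a A)
    have "(\<Prod>x\<in>#A. [:-x, 1:]) \<noteq> 0" by (auto simp: prod_mset_zero_iff)
    then show ?case using add by (simp add: proots_mult del: mult_pCons_left)
  qed simp
  finally have "proots P = A" .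
  have "size (proots P) = (\<Sum>w\<in>{w. poly P w = 0}. order w P)"
    using \<open>P \<noteq> 0\<close> by (simp add: size_multiset_overloaded_eq)
  also have "\<dots> = (\<Sum>w\<in>{w. poly P w = 0}. 1)"
    using \<open>rsquarefree P\<close> \<open>P \<noteq> 0\<close> by (intro sum.cong) (auto simp: rsquarefree_root_order)
  finally show ?thesis
    using A(1) deg \<open>proots P = A\<close> by (simp add: poly_P)
qed

lemma finite_roots_of_unity:
  fixes N :: nat
  assumes "N > 0"
  shows "finite {w :: 'f :: {alg_closed_field, field_char_0}. w ^ N = 1}"
  using card_roots_of_unity[OF assms, where 'f = 'f] assms by (intro card_ge_0_finite) simp

text \<open>There are only \<open>k < N\<close> roots of \<open>w^k = 1\<close>, so some
  \<open>N\<close>-th root of unity \<open>v\<close> has \<open>v^k \<noteq> 1\<close>.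
  Multiplication by \<open>v\<close> permutes the \<open>N\<close>-th roots and scales the sum by
  \<open>v^k\<close>, so the sum vanishes.\<close>

lemma sum_roots_of_unity_power:
  fixes N k :: nat
  assumes "0 < k" "k < N"
  shows "(\<Sum>w\<in>{w :: 'f :: {alg_closed_field, field_char_0}. w ^ N = 1}. w ^ k) = 0"
proof -
  let ?R = "\<lambda>N. {w :: 'f. w ^ N = 1}"
  have "\<not> ?R N \<subseteq> ?R k"
    using assms card_mono[of "?R k" "?R N"] finite_roots_of_unity[of k, where 'f = 'f]
      card_roots_of_unity[of N, where 'f = 'f] card_roots_of_unity[of k, where 'f = 'f] by auto
  then obtain v :: 'f where v: "v ^ N = 1" "v ^ k \<noteq> 1" by blast
  have "v \<noteq> 0" using v(1) assms by (auto simp: power_0_left)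
  have "(\<Sum>w\<in>?R N. w ^ k) = (\<Sum>w\<in>?R N. (v * w) ^ k)"
    by (rule sum.reindex_bij_witness[of _ "\<lambda>w. v * w" "\<lambda>w. w / v"])
      (use v \<open>v \<noteq> 0\<close> in \<open>auto simp: power_mult_distrib power_divide\<close>)
  also have "\<dots> = v ^ k * (\<Sum>w\<in>?R N. w ^ k)"
    by (simp add: power_mult_distrib sum_distrib_left)
  finally show ?thesis using v(2) by auto
qed

text \<open>Expanding the product yields each exponent below \<open>p^m\<close> exactly once,
  through its base-\<open>p\<close> digits. The induction splits off the leading digit.\<close>

lemma prod_digit_power_sums:
  fixes z :: "'a :: comm_semiring_1"
  shows "(\<Prod>j<m. \<Sum>k<p. (z ^ (p ^ j)) ^ k) = (\<Sum>k<p ^ m. z ^ k)"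
proof (induction m)
  case (Suc m)
  have "(\<Sum>k<p ^ Suc m. z ^ k) = (\<Sum>i<p. \<Sum>k\<in>{i * p ^ m..<i * p ^ m + p ^ m}. z ^ k)"
    by (simp add: sum.nat_group)
  also have "\<dots> = (\<Sum>i<p. \<Sum>k<p ^ m. z ^ (i * p ^ m + k))"
  proof (rule sum.cong)
    fix i
    show "(\<Sum>k\<in>{i * p ^ m..<i * p ^ m + p ^ m}. z ^ k) = (\<Sum>k<p ^ m. z ^ (i * p ^ m + k))"
      using sum.shift_bounds_nat_ivl[of "\<lambda>k. z ^ k" 0 "i * p ^ m" "p ^ m"]
      by (simp add: lessThan_atLeast0 add.commute)
  qed simp
  also have "\<dots> = (\<Sum>k<p ^ m. z ^ k) * (\<Sum>i<p. (z ^ (p ^ m)) ^ i)"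
    by (subst sum_product, subst sum.swap)
      (simp add: power_add mult.commute flip: power_mult)
  finally show ?case using Suc by simp
qed simp

lemma mult_geometric_sum:
  fixes z :: "'a :: comm_ring_1"
  assumes "z ^ N = 1"
  shows "z * (\<Sum>k<N. z ^ k) = (\<Sum>k<N. z ^ k)"
  using power_diff_1_eq[of z N] assms by (simp add: algebra_simps)

text \<open>The group elements acting on \<open>E\<close> as scalars are closed under differences,
  hence are all of the group. Linear combinations of them act as scalars too.\<close>

lemma eigenvector_group_algebra:
  fixes E :: "'g::ab_group_add \<Rightarrow>\<^sub>0 'f::field"
  assumes gen: "group_closure S = UNIV"
    and S: "\<And>s. s \<in> S \<Longrightarrow>
      \<exists>c. Poly_Mapping.single s 1 * E = Poly_Mapping.single 0 c * E"
  shows "\<exists>c. a * E = Poly_Mapping.single 0 c * E"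
proof -
  let ?single = "Poly_Mapping.single :: 'g \<Rightarrow> 'f \<Rightarrow> _"
  have group: "\<exists>c. ?single g 1 * E = ?single 0 c * E" for g
  proof -
    have "g \<in> group_closure S" by (simp add: gen)
    then show ?thesis
    proof induction
      case (base s)
      then show ?case using S by auto
    next
      case (diff s t)
      then obtain c d where c: "?single s 1 * E = ?single 0 c * E"
        and d: "?single t 1 * E = ?single 0 d * E" by blast
      have "?single (s - t) 1 * (?single t 1 * E) = ?single s 1 * E"
        by (simp add: mult_single flip: mult.assoc)
      then have *: "?single 0 d * (?single (s - t) 1 * E) = ?single 0 c * E"
        unfolding c d by (simp add: ac_simps)
      show ?case
      \<comment> \<open>To divide by \<open>d\<close>, the case \<open>d = 0\<close> is set apart:
        \<open>t\<close> acts invertibly, so there \<open>E = 0\<close>.\<close>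
      proof (cases "d = 0")
        case True
        have "E = ?single (- t) 1 * (?single t 1 * E)"
          by (simp add: mult_single flip: mult.assoc)
        then have "E = 0" using True d by simp
        then show ?thesis by simp
      next
        case False
        have "?single (s - t) 1 * E = ?single 0 (inverse d) * (?single 0 d * (?single (s - t) 1 * E))"
          using False by (simp add: mult_single flip: mult.assoc)
        also have "\<dots> = ?single 0 (inverse d * c) * E"
          unfolding * by (simp add: mult_single flip: mult.assoc)
        finally show ?thesis by blast
      qed
    qed
  qed
  show ?thesis
  proof (induction a rule: update_induct)
    case const
    show ?case by (rule exI[of _ 0]) simp
  next
    case (update f g b)
    obtain c where c: "f * E = ?single 0 c * E" using update by blast
    obtain d where d: "?single g 1 * E = ?single 0 d * E" using group by blast
    \<comment> \<open>The key \<open>g\<close> lies outside the support of \<open>f\<close>, so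
      updating there is adding a term.\<close>
    have "Poly_Mapping.update g b f = f + ?single 0 b * ?single g 1"
      using update(1)
      by (intro poly_mapping_eqI)
        (auto simp: lookup_update lookup_add lookup_single mult_single when_def in_keys_iff)
    then have "Poly_Mapping.update g b f * E = ?single 0 c * E + ?single 0 b * (?single 0 d * E)"
      by (simp add: distrib_right c mult.assoc d)
    also have "\<dots> = ?single 0 (c + b * d) * E"
      by (simp add: single_add distrib_right mult_single flip: mult.assoc)
    finally show ?case by blast
  qed
qed

theorem theorem4p1:
  fixes p n :: nat
    and x :: "nat \<Rightarrow> 'g::ab_group_add"
    and e :: "'g \<Rightarrow>\<^sub>0 'f::{alg_closed_field, field_char_0}"
  assumes "prime p" and "n \<ge> 1"
    and card_G: "card (UNIV :: 'g set) = p ^ n"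
    and generators: "group_closure (x ` {1..n}) = UNIV"
    and relation_1: "(\<Sum>_<p. x 1) = 0"
    and relations: "\<And>i. i \<in> {2..n} \<Longrightarrow> (\<Sum>_<p. x i) = x (i - 1)"
    and "primitive_central_idempotent e"
  shows "\<exists>\<zeta> :: nat \<Rightarrow> 'f.
           \<zeta> n ^ (p ^ n) = 1 \<and>
           (\<forall>i\<in>{2..n}. \<zeta> i ^ p = \<zeta> (i - 1)) \<and>
           (\<forall>i\<in>{1..n}. \<zeta> i ^ (p ^ i) = 1) \<and>
           e = (\<Prod>i=1..n. e_elem p (Poly_Mapping.single (x i) (\<zeta> i)))"
proof -
  let ?single = "Poly_Mapping.single :: 'g \<Rightarrow> 'f \<Rightarrow> _"
  define N where "N = p ^ n"
  have "p > 0" using \<open>prime p\<close> prime_gt_0_nat by blast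
  then have "N > 0" by (simp add: N_def)
  define R where "R = {w :: 'f. w ^ N = 1}"
  define y where "y w = ?single (x n) w" for w
  define E where "E w = ?single 0 (1 / of_nat N) * (\<Sum>k<N. y w ^ k)" for w
  \<comment> \<open>Each \<open>p\<close>-th power moves one step down the chain of generators. The
    bound \<open>j < n\<close> stops at \<open>x 1\<close>; one more step, by
    \<open>relation_1\<close>, reaches the neutral element.\<close>
  have y_power: "y w ^ (p ^ j) = ?single (x (n - j)) (w ^ (p ^ j))" if "j < n" for w j
    using that
  proof (induction j)
    case (Suc j)
    have "y w ^ (p ^ Suc j) = (y w ^ (p ^ j)) ^ p"
      by (simp add: mult.commute flip: power_mult)
    also have "\<dots> = ?single (\<Sum>_<p. x (n - j)) (w ^ (p ^ Suc j))"
      using Suc by (simp add: single_power mult.commute flip: power_mult)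
    also have "(\<Sum>_<p. x (n - j)) = x (n - Suc j)"
      using Suc.prems relations[of "n - j"] by simp
    finally show ?case .
  qed (simp add: y_def)
  have y_N: "y w ^ N = 1" if "w \<in> R" for w
  proof -
    have N: "N = p ^ (n - 1) * p"
      using \<open>n \<ge> 1\<close> by (simp add: N_def power_eq_if)
    have "y w ^ N = ?single (x 1) (w ^ (p ^ (n - 1))) ^ p"
      using y_power[of "n - 1" w] \<open>n \<ge> 1\<close> by (simp add: N power_mult)
    also have "\<dots> = ?single 0 (w ^ N)"
      using relation_1 by (simp add: single_power N power_mult)
    finally show ?thesis using that by (simp add: R_def)
  qed
  have yE: "y w * E w = E w" if "w \<in> R" for w
    using mult_geometric_sum[OF y_N[OF that]] by (simp add: E_def mult.left_commute[of "y w"])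
  have yE_power: "y w ^ k * E w = E w" if "w \<in> R" for w k
    by (induction k) (simp_all add: yE[OF that] mult.assoc mult.left_commute)
  have E_prod: "(\<Prod>i=1..n. e_elem p (?single (x i) (w ^ (p ^ (n - i))))) = E w" for w
  proof -
    have "(\<Prod>i=1..n. e_elem p (?single (x i) (w ^ (p ^ (n - i)))))
        = (\<Prod>j<n. e_elem p (y w ^ (p ^ j)))"
      by (rule prod.reindex_bij_witness[of _ "\<lambda>j. n - j" "\<lambda>i. n - i"]) (auto simp: y_power)
    also have "\<dots> = ?single 0 (1 / of_nat p) ^ n * (\<Sum>k<p ^ n. y w ^ k)"
      by (simp add: e_elem_def prod.distrib prod_digit_power_sums)
    also have "?single 0 (1 / of_nat p) ^ n = ?single 0 (1 / of_nat N)"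
      by (simp add: single_power N_def power_one_over)
    finally show ?thesis by (simp add: E_def N_def)
  qed
  have E_eigen: "\<exists>c. a * E w = ?single 0 c * E w" if "w \<in> R" for a w
  proof (rule eigenvector_group_algebra[OF generators])
    fix s assume "s \<in> x ` {1..n}"
    then obtain i where i: "i \<in> {1..n}" "s = x i" by blast
    define v where "v = w ^ (p ^ (n - i))"
    have "w \<noteq> 0" using that \<open>N > 0\<close> by (auto simp: R_def power_0_left)
    then have "v \<noteq> 0" by (simp add: v_def)
    have "?single s v = y w ^ (p ^ (n - i))"
      using y_power[of "n - i" w] i by (simp add: v_def)
    \<comment> \<open>A power of \<open>y w\<close> fixes \<open>E w\<close>, and it is
      \<open>v\<close> times the generator \<open>s\<close>; hence \<open>s\<close> acts as
      \<open>inverse v\<close>.\<close>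
    then have "?single s v * E w = E w"
      using yE_power[OF that] by simp
    moreover have "?single s 1 = ?single 0 (inverse v) * ?single s v"
      using \<open>v \<noteq> 0\<close> by (simp add: mult_single)
    ultimately have "?single s 1 * E w = ?single 0 (inverse v) * E w"
      by (simp add: mult.assoc)
    then show "\<exists>c. ?single s 1 * E w = ?single 0 c * E w" by blast
  qed
  have sum_E: "(\<Sum>w\<in>R. E w) = 1"
  proof -
    have y_pow: "y w ^ k = ?single 0 (w ^ k) * ?single (\<Sum>_<k. x n) 1" for w k
      by (simp add: y_def single_power mult_single)
    have single_sum: "?single 0 (\<Sum>w\<in>R. h w) = (\<Sum>w\<in>R. ?single 0 (h w))" for h
      by (induction R rule: infinite_finite_induct) (simp_all add: single_add)
    \<comment> \<open>After swapping the sums, the \<open>k\<close>-th power of the generator has as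
      coefficient the power sum of the roots of unity, so only \<open>k = 0\<close> survives, with
      value \<open>N\<close>.\<close>
    have "(\<Sum>w\<in>R. E w) = ?single 0 (1 / of_nat N) *
        (\<Sum>k<N. ?single 0 (\<Sum>w\<in>R. w ^ k) * ?single (\<Sum>_<k. x n) 1)"
      unfolding E_def y_pow
      by (subst sum_distrib_left[symmetric], subst sum.swap)
        (simp add: single_sum sum_distrib_right)
    also have "(\<Sum>k<N. ?single 0 (\<Sum>w\<in>R. w ^ k) * ?single (\<Sum>_<k. x n) 1)
        = (\<Sum>k<N. if k = 0 then ?single 0 (of_nat N) else 0)"
    proof (rule sum.cong)
      fix k assume "k \<in> {..<N}"
      then show "?single 0 (\<Sum>w\<in>R. w ^ k) * ?single (\<Sum>_<k. x n) 1
          = (if k = 0 then ?single 0 (of_nat N) else 0)"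
        using sum_roots_of_unity_power[of k N, where 'f = 'f]
          card_roots_of_unity[OF \<open>N > 0\<close>, where 'f = 'f]
        by (cases "k = 0") (simp_all add: R_def)
    qed simp
    finally show ?thesis
      using \<open>N > 0\<close> by (simp add: mult_single flip: single_of_nat)
  qed
  have "e * e = e" "e \<noteq> 0"
    and prim: "\<And>f g. f * f = f \<Longrightarrow> g * g = g \<Longrightarrow> f * g = 0 \<Longrightarrow> e = f + g \<Longrightarrow> f = 0 \<or> g = 0"
    using \<open>primitive_central_idempotent e\<close>
    by (auto simp: primitive_central_idempotent_def central_idempotent_def mult.commute)
  have "(\<Sum>w\<in>R. e * E w) \<noteq> 0"
    using \<open>e \<noteq> 0\<close> sum_E by (simp flip: sum_distrib_left)
  then obtain w where w: "w \<in> R" "e * E w \<noteq> 0"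
    by (meson sum.neutral)
  have EE: "E w * E w = E w"
  proof -
    \<comment> \<open>Each of the \<open>N\<close> powers of \<open>y w\<close> in the first factor
      fixes the second.\<close>
    have "E w * E w = ?single 0 (1 / of_nat N) * (of_nat N * E w)"
      by (subst (1) E_def) (simp add: mult.assoc sum_distrib_right yE_power[OF w(1)])
    also have "\<dots> = E w"
      using \<open>N > 0\<close> by (simp add: mult_single flip: mult.assoc single_of_nat)
    finally show ?thesis .
  qed
  obtain c where c: "e * E w = ?single 0 c * E w" using E_eigen[OF w(1)] by blast
  have "c \<noteq> 0" using c w(2) by auto
  \<comment> \<open>Applying the idempotent \<open>e\<close> twice gives \<open>c^2 = c\<close> on
    \<open>E w\<close>; cancelling the nonzero \<open>c\<close> makes \<open>e\<close> act as
    1.\<close>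
  have "?single 0 c * (?single 0 c * E w) = ?single 0 c * E w"
    using c \<open>e * e = e\<close> by (metis mult.assoc mult.left_commute)
  then have "?single 0 (inverse c) * (?single 0 c * (?single 0 c * E w))
      = ?single 0 (inverse c) * (?single 0 c * E w)" by simp
  then have eE: "e * E w = E w"
    using c \<open>c \<noteq> 0\<close> by (simp add: mult_single flip: mult.assoc)
  \<comment> \<open>Here \<open>e\<close> is split into the orthogonal idempotents
    \<open>E w\<close> and \<open>e - E w\<close>.\<close>
  have "E w = 0 \<or> e - E w = 0"
    by (rule prim) (simp_all add: EE eE \<open>e * e = e\<close> algebra_simps)
  then have "e = E w" using w(2) by auto
  moreover have pow: "w ^ (p ^ n) = 1" using w(1) by (simp add: R_def N_def)
  ultimately show ?thesis
  proof (intro exI[of _ "\<lambda>i. w ^ (p ^ (n - i))"] conjI ballI)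
    show "(w ^ (p ^ (n - i))) ^ p = w ^ (p ^ (n - (i - 1)))" if "i \<in> {2..n}" for i
    proof -
      have "n - (i - 1) = Suc (n - i)" using that by auto
      then show ?thesis by (simp add: mult.commute flip: power_mult)
    qed
    show "(w ^ (p ^ (n - i))) ^ (p ^ i) = 1" if "i \<in> {1..n}" for i
      using that pow by (simp flip: power_mult power_add)
  qed (use E_prod[of w] in simp_all)
qed

end
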